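(* Let $(M,\le,\ldots)$ be a definably complete expansion of a linear order, let $\mathfrak U$ be a monster model of its theory and let $A\subseteq\mathfrak U$ be small. Then the map $S_1(A)/\mathord\approx\;\to\operatorname{CC}(A)$ sending the $\approx$-class of a type $p$ to the cut of $p$ is well defined and is an isomorphism of linear orders.
   Context: A linearly ordered structure is definably complete if every nonempty definable subset bounded above has a supremum and every one bounded below has an infimum. For $p,q\in S_1(A)$, $p\lessapprox q$ means there are $\alpha\models p$, $\beta\models q$ in $\mathfrak U$ with $\alpha\le\beta$; $p\approx q$ means $p\lessapprox q\lessapprox p$; $S_1(A)/\mathord\approx$ is ordered by the induced relation. $\operatorname{CC}(A)$ (consistent cuts over $A$) is the set of quantifier-free $1$-types in the language $\{\le\}$ over $\operatorname{dcl}(A)$ (definable closure computed in the full structure), equivalently the set of cuts $(L,R)$ of $\operatorname{dcl}(A)$ (with $L\cup R=\operatorname{dcl}(A)$, $L\le R$) realised by some element of $\mathfrak U$, with its natural linear order. The cut of $p$ is determined by $L_p=\{a\in\operatorname{dcl}(A):p(x)\vdash x\ge a\}$ and $R_p=\{a\in\operatorname{dcl}(A):p(x)\vdash x\le a\}$. *)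

theory Defs
  imports Main
begin

unbundle cardinal_syntax

section \<open>First-order languages, formulas and structures\<close>

datatype 'f tm = Var nat | Fun 'f "'f tm list"

datatype ('f, 'r) fm =
    Eq "'f tm" "'f tm"
  | Rel 'r "'f tm list"
  | Neg "('f, 'r) fm"
  | And "('f, 'r) fm" "('f, 'r) fm"
  | Ex nat "('f, 'r) fm"

text \<open>A symbol of a language is a name together with an arity; constants are function symbols of
  arity 0.\<close>

record ('f, 'r) lang =
  funs :: "('f \<times> nat) set"
  rels :: "('r \<times> nat) set"

text \<open>The universe of a structure is the whole type \<open>'a\<close>. The values of \<open>fn\<close> and
  \<open>rl\<close> at names and arities outside the language are never consulted by a well-formed formula.\<close>

record ('f, 'r, 'a) struct =
  fn :: "'f \<Rightarrow> 'a list \<Rightarrow> 'a"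
  rl :: "'r \<Rightarrow> 'a list \<Rightarrow> bool"

fun wf_tm :: "('f, 'r) lang \<Rightarrow> 'f tm \<Rightarrow> bool" where
  "wf_tm L (Var n) \<longleftrightarrow> True"
| "wf_tm L (Fun f ts) \<longleftrightarrow> (f, length ts) \<in> funs L \<and> (\<forall>t \<in> set ts. wf_tm L t)"

primrec wf_fm :: "('f, 'r) lang \<Rightarrow> ('f, 'r) fm \<Rightarrow> bool" where
  "wf_fm L (Eq s t) \<longleftrightarrow> wf_tm L s \<and> wf_tm L t"
| "wf_fm L (Rel r ts) \<longleftrightarrow> (r, length ts) \<in> rels L \<and> (\<forall>t \<in> set ts. wf_tm L t)"
| "wf_fm L (Neg \<phi>) \<longleftrightarrow> wf_fm L \<phi>"
| "wf_fm L (And \<phi> \<psi>) \<longleftrightarrow> wf_fm L \<phi> \<and> wf_fm L \<psi>"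
| "wf_fm L (Ex n \<phi>) \<longleftrightarrow> wf_fm L \<phi>"

fun fv_tm :: "'f tm \<Rightarrow> nat set" where
  "fv_tm (Var n) = {n}"
| "fv_tm (Fun f ts) = (\<Union>t \<in> set ts. fv_tm t)"

primrec fv :: "('f, 'r) fm \<Rightarrow> nat set" where
  "fv (Eq s t) = fv_tm s \<union> fv_tm t"
| "fv (Rel r ts) = (\<Union>t \<in> set ts. fv_tm t)"
| "fv (Neg \<phi>) = fv \<phi>"
| "fv (And \<phi> \<psi>) = fv \<phi> \<union> fv \<psi>"
| "fv (Ex n \<phi>) = fv \<phi> - {n}"

primrec eval_tm :: "('f, 'r, 'a) struct \<Rightarrow> (nat \<Rightarrow> 'a) \<Rightarrow> 'f tm \<Rightarrow> 'a" where
  "eval_tm M v (Var n) = v n"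
| "eval_tm M v (Fun f ts) = fn M f (map (eval_tm M v) ts)"

primrec sat :: "('f, 'r, 'a) struct \<Rightarrow> (nat \<Rightarrow> 'a) \<Rightarrow> ('f, 'r) fm \<Rightarrow> bool" where
  "sat M v (Eq s t) \<longleftrightarrow> eval_tm M v s = eval_tm M v t"
| "sat M v (Rel r ts) \<longleftrightarrow> rl M r (map (eval_tm M v) ts)"
| "sat M v (Neg \<phi>) \<longleftrightarrow> \<not> sat M v \<phi>"
| "sat M v (And \<phi> \<psi>) \<longleftrightarrow> sat M v \<phi> \<and> sat M v \<psi>"
| "sat M v (Ex n \<phi>) \<longleftrightarrow> (\<exists>x. sat M (v(n := x)) \<phi>)"

definition Th :: "('f, 'r) lang \<Rightarrow> ('f, 'r, 'a) struct \<Rightarrow> ('f, 'r) fm set" where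
  "Th L M = {\<phi>. wf_fm L \<phi> \<and> fv \<phi> = {} \<and> (\<forall>v. sat M v \<phi>)}"

definition models :: "('f, 'r, 'a) struct \<Rightarrow> ('f, 'r) fm set \<Rightarrow> bool" where
  "models M T \<longleftrightarrow> (\<forall>\<phi> \<in> T. \<forall>v. sat M v \<phi>)"


section \<open>Parameters, definable sets and types\<close>

text \<open>The language \<open>L(A)\<close> adds to \<open>L\<close> a constant \<open>Inr a\<close> for each \<open>a \<in> A\<close>.
  The expansion \<open>with_params M\<close> interprets the constants of all elements, so it serves as the
  canonical \<open>L(A)\<close>-structure for every \<open>A\<close>.\<close>

definition lang_params :: "('f, 'r) lang \<Rightarrow> 'a set \<Rightarrow> ('f + 'a, 'r) lang" where
  "lang_params L A =
    \<lparr>funs = (\<lambda>(f, n). (Inl f, n)) ` funs L \<union> (\<lambda>a. (Inr a, 0)) ` A, rels = rels L\<rparr>"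

definition with_params :: "('f, 'r, 'a) struct \<Rightarrow> ('f + 'a, 'r, 'a) struct" where
  "with_params M = \<lparr>fn = case_sum (fn M) (\<lambda>a _. a), rl = rl M\<rparr>"

abbreviation Par :: "'a \<Rightarrow> ('f + 'a) tm" where
  "Par a \<equiv> Fun (Inr a) []"

text \<open>\<open>L(A)\<close>-formulas in the single variable \<open>x = Var 0\<close>.\<close>

definition fms1 :: "('f, 'r) lang \<Rightarrow> 'a set \<Rightarrow> ('f + 'a, 'r) fm set" where
  "fms1 L A = {\<phi>. wf_fm (lang_params L A) \<phi> \<and> fv \<phi> \<subseteq> {0}}"

definition sat1 :: "('f, 'r, 'a) struct \<Rightarrow> 'a \<Rightarrow> ('f + 'a, 'r) fm \<Rightarrow> bool" where
  "sat1 M b \<phi> \<longleftrightarrow> sat (with_params M) (\<lambda>_. b) \<phi>"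

definition definable_over ::
    "('f, 'r) lang \<Rightarrow> ('f, 'r, 'a) struct \<Rightarrow> 'a set \<Rightarrow> 'a set \<Rightarrow> bool" where
  "definable_over L M A D \<longleftrightarrow> (\<exists>\<phi> \<in> fms1 L A. D = {b. sat1 M b \<phi>})"

definition dcl :: "('f, 'r) lang \<Rightarrow> ('f, 'r, 'a) struct \<Rightarrow> 'a set \<Rightarrow> 'a set" where
  "dcl L M A = {b. definable_over L M A {b}}"

definition realises :: "('f, 'r, 'a) struct \<Rightarrow> 'a \<Rightarrow> ('f + 'a, 'r) fm set \<Rightarrow> bool" where
  "realises M b p \<longleftrightarrow> (\<forall>\<phi> \<in> p. sat1 M b \<phi>)"

text \<open>The space \<open>S\<^sub>1(A)\<close> of complete 1-types: complete sets of \<open>L(A)\<close>-formulas in \<open>x\<close> consistent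
  with the theory of \<open>M\<close> in \<open>L(A)\<close>, that is, finitely satisfiable in \<open>M\<close>.\<close>

definition S1 ::
    "('f, 'r) lang \<Rightarrow> ('f, 'r, 'a) struct \<Rightarrow> 'a set \<Rightarrow> ('f + 'a, 'r) fm set set" where
  "S1 L M A = {p. p \<subseteq> fms1 L A
      \<and> (\<forall>F. F \<subseteq> p \<and> finite F \<longrightarrow> (\<exists>b. realises M b F))
      \<and> (\<forall>\<phi> \<in> fms1 L A. \<phi> \<in> p \<or> Neg \<phi> \<in> p)}"

text \<open>\<open>p(x) \<turnstile> \<psi>(x)\<close>, read inside a monster model: every realisation of \<open>p\<close> satisfies \<open>\<psi>\<close>.\<close>

definition entails ::
    "('f, 'r, 'a) struct \<Rightarrow> ('f + 'a, 'r) fm set \<Rightarrow> ('f + 'a, 'r) fm \<Rightarrow> bool" where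
  "entails U p \<psi> \<longleftrightarrow> (\<forall>b. realises U b p \<longrightarrow> sat1 U b \<psi>)"


section \<open>Monster models\<close>

definition small :: "'k rel \<Rightarrow> 'a set \<Rightarrow> bool" where
  "small \<kappa> A \<longleftrightarrow> |A| <o \<kappa>"

definition saturated :: "'k rel \<Rightarrow> ('f, 'r) lang \<Rightarrow> ('f, 'r, 'a) struct \<Rightarrow> bool" where
  "saturated \<kappa> L U \<longleftrightarrow> (\<forall>A. small \<kappa> A \<longrightarrow> (\<forall>p \<in> S1 L U A. \<exists>b. realises U b p))"

definition elementary_map ::
    "('f, 'r) lang \<Rightarrow> ('f, 'r, 'a) struct \<Rightarrow> 'a set \<Rightarrow> ('a \<Rightarrow> 'a) \<Rightarrow> bool" where
  "elementary_map L U A g \<longleftrightarrow>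
    (\<forall>\<phi> v. wf_fm L \<phi> \<and> v ` fv \<phi> \<subseteq> A \<longrightarrow> (sat U v \<phi> \<longleftrightarrow> sat U (g \<circ> v) \<phi>))"

definition automorphism ::
    "('f, 'r) lang \<Rightarrow> ('f, 'r, 'a) struct \<Rightarrow> ('a \<Rightarrow> 'a) \<Rightarrow> bool" where
  "automorphism L U \<sigma> \<longleftrightarrow> bij \<sigma>
    \<and> (\<forall>(f, n) \<in> funs L. \<forall>xs. length xs = n \<longrightarrow> \<sigma> (fn U f xs) = fn U f (map \<sigma> xs))
    \<and> (\<forall>(r, n) \<in> rels L. \<forall>xs. length xs = n \<longrightarrow> (rl U r xs \<longleftrightarrow> rl U r (map \<sigma> xs)))"

definition strongly_homogeneous ::
    "'k rel \<Rightarrow> ('f, 'r) lang \<Rightarrow> ('f, 'r, 'a) struct \<Rightarrow> bool" where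
  "strongly_homogeneous \<kappa> L U \<longleftrightarrow>
    (\<forall>A g. small \<kappa> A \<and> elementary_map L U A g \<longrightarrow>
      (\<exists>\<sigma>. automorphism L U \<sigma> \<and> (\<forall>a \<in> A. \<sigma> a = g a)))"

text \<open>The cardinal \<open>\<kappa>\<close> exceeds \<open>|L|\<close>, the number of \<open>L\<close>-formulas; in particular it is uncountable.\<close>

definition monster_model ::
    "'k rel \<Rightarrow> ('f, 'r) lang \<Rightarrow> ('f, 'r) fm set \<Rightarrow> ('f, 'r, 'a) struct \<Rightarrow> bool" where
  "monster_model \<kappa> L T U \<longleftrightarrow> Card_order \<kappa> \<and> |{\<phi>. wf_fm L \<phi>}| <o \<kappa>
    \<and> models U T \<and> saturated \<kappa> L U \<and> strongly_homogeneous \<kappa> L U"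


section \<open>Definably complete expansions of linear orders\<close>

definition le :: "'r \<Rightarrow> ('f, 'r, 'a) struct \<Rightarrow> 'a \<Rightarrow> 'a \<Rightarrow> bool" where
  "le r M x y \<longleftrightarrow> rl M r [x, y]"

definition expands_linear_order ::
    "('f, 'r) lang \<Rightarrow> 'r \<Rightarrow> ('f, 'r, 'a) struct \<Rightarrow> bool" where
  "expands_linear_order L r M \<longleftrightarrow> (r, 2) \<in> rels L \<and> linear_order {(x, y). le r M x y}"

definition upper_bound :: "'r \<Rightarrow> ('f, 'r, 'a) struct \<Rightarrow> 'a set \<Rightarrow> 'a \<Rightarrow> bool" where
  "upper_bound r M D u \<longleftrightarrow> (\<forall>x \<in> D. le r M x u)"

definition lower_bound :: "'r \<Rightarrow> ('f, 'r, 'a) struct \<Rightarrow> 'a set \<Rightarrow> 'a \<Rightarrow> bool" where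
  "lower_bound r M D l \<longleftrightarrow> (\<forall>x \<in> D. le r M l x)"

definition is_supremum :: "'r \<Rightarrow> ('f, 'r, 'a) struct \<Rightarrow> 'a set \<Rightarrow> 'a \<Rightarrow> bool" where
  "is_supremum r M D s \<longleftrightarrow>
    upper_bound r M D s \<and> (\<forall>u. upper_bound r M D u \<longrightarrow> le r M s u)"

definition is_infimum :: "'r \<Rightarrow> ('f, 'r, 'a) struct \<Rightarrow> 'a set \<Rightarrow> 'a \<Rightarrow> bool" where
  "is_infimum r M D i \<longleftrightarrow>
    lower_bound r M D i \<and> (\<forall>l. lower_bound r M D l \<longrightarrow> le r M l i)"

text \<open>Definable means definable with arbitrary parameters from \<open>M\<close>.\<close>

definition definably_complete ::
    "('f, 'r) lang \<Rightarrow> 'r \<Rightarrow> ('f, 'r, 'a) struct \<Rightarrow> bool" where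
  "definably_complete L r M \<longleftrightarrow>
    (\<forall>D. definable_over L M UNIV D \<and> D \<noteq> {} \<longrightarrow>
      ((\<exists>u. upper_bound r M D u) \<longrightarrow> (\<exists>s. is_supremum r M D s)) \<and>
      ((\<exists>l. lower_bound r M D l) \<longrightarrow> (\<exists>i. is_infimum r M D i)))"


section \<open>The ordered quotient of the type space\<close>

definition lessapprox :: "'r \<Rightarrow> ('f, 'r, 'a) struct
    \<Rightarrow> ('f + 'a, 'r) fm set \<Rightarrow> ('f + 'a, 'r) fm set \<Rightarrow> bool" where
  "lessapprox r U p q \<longleftrightarrow> (\<exists>\<alpha> \<beta>. realises U \<alpha> p \<and> realises U \<beta> q \<and> le r U \<alpha> \<beta>)"

definition approx :: "('f, 'r) lang \<Rightarrow> 'r \<Rightarrow> ('f, 'r, 'a) struct \<Rightarrow> 'a set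
    \<Rightarrow> ('f + 'a, 'r) fm set rel" where
  "approx L r U A =
    {(p, q). p \<in> S1 L U A \<and> q \<in> S1 L U A \<and> lessapprox r U p q \<and> lessapprox r U q p}"

definition S1_quot :: "('f, 'r) lang \<Rightarrow> 'r \<Rightarrow> ('f, 'r, 'a) struct \<Rightarrow> 'a set
    \<Rightarrow> ('f + 'a, 'r) fm set set set" where
  "S1_quot L r U A = S1 L U A // approx L r U A"

definition S1_quot_order :: "('f, 'r) lang \<Rightarrow> 'r \<Rightarrow> ('f, 'r, 'a) struct \<Rightarrow> 'a set
    \<Rightarrow> ('f + 'a, 'r) fm set set rel" where
  "S1_quot_order L r U A =
    {(X, Y). X \<in> S1_quot L r U A \<and> Y \<in> S1_quot L r U A
      \<and> (\<exists>p \<in> X. \<exists>q \<in> Y. lessapprox r U p q)}"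


section \<open>Consistent cuts\<close>

text \<open>The quantifier-free \<open>{\<le>}\<close>-type of an element \<open>b\<close> over \<open>C\<close> is recorded by the pair of the
  elements of \<open>C\<close> below and above \<open>b\<close>; both inequalities are weak, so an element \<open>b \<in> C\<close> belongs
  to both sides. A pair is realised by \<open>b\<close> when it is exactly the pair of \<open>b\<close>: if \<open>b \<in> C\<close>, then
  \<open>b\<close> does not realise the cut with left side \<open>{a \<in> C. a \<le> b}\<close> and right side
  \<open>{a \<in> C. b < a}\<close>, which asks for an element strictly above \<open>b\<close>.\<close>

definition realises_cut ::
    "'r \<Rightarrow> ('f, 'r, 'a) struct \<Rightarrow> 'a set \<Rightarrow> 'a \<Rightarrow> 'a set \<times> 'a set \<Rightarrow> bool" where
  "realises_cut r U C b = (\<lambda>(Lo, Up). Lo = {a \<in> C. le r U a b} \<and> Up = {a \<in> C. le r U b a})"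

definition CC :: "('f, 'r) lang \<Rightarrow> 'r \<Rightarrow> ('f, 'r, 'a) struct \<Rightarrow> 'a set
    \<Rightarrow> ('a set \<times> 'a set) set" where
  "CC L r U A = {(Lo, Up). Lo \<union> Up = dcl L U A \<and> (\<forall>x \<in> Lo. \<forall>y \<in> Up. le r U x y)
      \<and> (\<exists>b. realises_cut r U (dcl L U A) b (Lo, Up))}"

text \<open>Both sides have to be compared, since neither of them determines the cut.\<close>

definition CC_order :: "('f, 'r) lang \<Rightarrow> 'r \<Rightarrow> ('f, 'r, 'a) struct \<Rightarrow> 'a set
    \<Rightarrow> ('a set \<times> 'a set) rel" where
  "CC_order L r U A =
    {((Lo, Up), (Lo', Up')). (Lo, Up) \<in> CC L r U A \<and> (Lo', Up') \<in> CC L r U A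
      \<and> Lo \<subseteq> Lo' \<and> Up' \<subseteq> Up}"

definition cut_of :: "('f, 'r) lang \<Rightarrow> 'r \<Rightarrow> ('f, 'r, 'a) struct \<Rightarrow> 'a set
    \<Rightarrow> ('f + 'a, 'r) fm set \<Rightarrow> 'a set \<times> 'a set" where
  "cut_of L r U A p =
    ({a \<in> dcl L U A. entails U p (Rel r [Par a, Var 0])},
     {a \<in> dcl L U A. entails U p (Rel r [Var 0, Par a])})"

text \<open>The map induced by \<open>cut_of\<close> on classes; it is meaningful once \<open>cut_of\<close> is constant on them.\<close>

definition class_cut :: "('f, 'r) lang \<Rightarrow> 'r \<Rightarrow> ('f, 'r, 'a) struct \<Rightarrow> 'a set
    \<Rightarrow> ('f + 'a, 'r) fm set set \<Rightarrow> 'a set \<times> 'a set" where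
  "class_cut L r U A X = the_elem (cut_of L r U A ` X)"

definition linear_order_iso :: "'x set \<Rightarrow> 'x rel \<Rightarrow> 'y set \<Rightarrow> 'y rel \<Rightarrow> ('x \<Rightarrow> 'y) \<Rightarrow> bool" where
  "linear_order_iso X R Y S h \<longleftrightarrow> linear_order_on X R \<and> linear_order_on Y S \<and> bij_betw h X Y
    \<and> (\<forall>x \<in> X. \<forall>x' \<in> X. (x, x') \<in> R \<longleftrightarrow> (h x, h x') \<in> S)"

end

theory Submission
  imports Defs
begin

text \<open>Everything reduces to one equivalence: \<open>p \<lessapprox> q\<close> holds iff the cut of \<open>p\<close> is at most the cut of
  \<open>q\<close>. The cut of \<open>p\<close> can be read off any realisation of \<open>p\<close>, which gives one direction. For the
  other, suppose that all realisations of \<open>q\<close> lie strictly below all realisations of \<open>p\<close>. By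
  saturation there are an \<open>A\<close>-definable \<open>P\<close> containing \<open>p(\<UU>)\<close> and a realisation \<open>\<beta>\<close> of \<open>q\<close> strictly
  below \<open>P\<close>. The set of all strict lower bounds of \<open>P\<close> is \<open>A\<close>-definable, contains \<open>q(\<UU>)\<close> and is
  bounded by each realisation of \<open>p\<close>; since definable completeness is a first-order scheme,
  it has a supremum \<open>s\<close>, and \<open>s \<in> dcl A\<close> satisfies \<open>q(\<UU>) \<le> s \<le> p(\<UU>)\<close>. If the cut of \<open>p\<close> were at
  most that of \<open>q\<close>, then \<open>s\<close> would realise both types, a contradiction.\<close>

section \<open>Formulas and their truth sets\<close>

lemma with_params_simps [simp]:
  "fn (with_params M) (Inl f) xs = fn M f xs"
  "fn (with_params M) (Inr a) xs = a"
  "rl (with_params M) = rl M"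
  by (simp_all add: with_params_def)

lemma eval_tm_cong: "(\<And>n. n \<in> fv_tm t \<Longrightarrow> v n = w n) \<Longrightarrow> eval_tm M v t = eval_tm M w t"
proof (induction t)
  case (Fun f ts)
  have "eval_tm M v t = eval_tm M w t" if "t \<in> set ts" for t
    by (rule Fun.IH[OF that]) (rule Fun.prems, use that in auto)
  then show ?case by (metis (no_types, lifting) eval_tm.simps(2) map_eq_conv)
qed simp

lemma sat_cong: "(\<And>n. n \<in> fv \<phi> \<Longrightarrow> v n = w n) \<Longrightarrow> sat M v \<phi> \<longleftrightarrow> sat M w \<phi>"
proof (induction \<phi> arbitrary: v w)
  case (Eq s t)
  then have "eval_tm M v s = eval_tm M w s" "eval_tm M v t = eval_tm M w t"
    by (auto intro: eval_tm_cong)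
  then show ?case by simp
next
  case (Rel r ts)
  have "eval_tm M v t = eval_tm M w t" if "t \<in> set ts" for t
    by (rule eval_tm_cong, rule Rel.prems) (use that in auto)
  then have "map (eval_tm M v) ts = map (eval_tm M w) ts" by simp
  then show ?case by (simp only: sat.simps)
next
  case (And \<phi> \<psi>)
  have "sat M v \<phi> \<longleftrightarrow> sat M w \<phi>" "sat M v \<psi> \<longleftrightarrow> sat M w \<psi>"
    by (rule And.IH, rule And.prems, simp)+
  then show ?case by simp
next
  case (Neg \<phi>)
  have "sat M v \<phi> \<longleftrightarrow> sat M w \<phi>"
    by (rule Neg.IH, rule Neg.prems, simp)
  then show ?case by simp
next
  case (Ex n \<phi>)
  have "sat M (v(n := x)) \<phi> \<longleftrightarrow> sat M (w(n := x)) \<phi>" for x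
    by (rule Ex.IH) (use Ex.prems in auto)
  then show ?case by simp
qed

lemma finite_fv_tm: "finite (fv_tm t)"
  by (induction t) auto

lemma finite_fv: "finite (fv \<phi>)"
  by (induction \<phi>) (auto simp: finite_fv_tm)

text \<open>Definability is handled semantically: \<open>P\<close> ranges over predicates of whole
  assignments, and closure rules replace the explicit construction of formulas in several
  variables.\<close>

definition expressible ::
    "('f, 'r) lang \<Rightarrow> ('f, 'r, 'a) struct \<Rightarrow> ((nat \<Rightarrow> 'a) \<Rightarrow> bool) \<Rightarrow> bool" where
  "expressible L M P \<longleftrightarrow> (\<exists>\<phi>. wf_fm L \<phi> \<and> (\<forall>v. sat M v \<phi> \<longleftrightarrow> P v))"

lemma expressible_not: "expressible L M P \<Longrightarrow> expressible L M (\<lambda>v. \<not> P v)"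
  unfolding expressible_def by (metis sat.simps(3) wf_fm.simps(3))

lemma expressible_conj:
  "expressible L M P \<Longrightarrow> expressible L M Q \<Longrightarrow> expressible L M (\<lambda>v. P v \<and> Q v)"
  unfolding expressible_def by (metis sat.simps(4) wf_fm.simps(4))

lemma expressible_ex: "expressible L M P \<Longrightarrow> expressible L M (\<lambda>v. \<exists>x. P (v(n := x)))"
  unfolding expressible_def by (metis sat.simps(5) wf_fm.simps(5))

lemma expressible_eq: "expressible L M (\<lambda>v. v i = v j)"
  unfolding expressible_def by (rule exI[of _ "Eq (Var i) (Var j)"]) simp

lemma expressible_le:
  assumes "(r, 2) \<in> rels L"
  shows "expressible (lang_params L A) (with_params M) (\<lambda>v. le r M (v i) (v j))"
  unfolding expressible_def
  by (rule exI[of _ "Rel r [Var i, Var j]"])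
     (use assms in \<open>simp add: le_def lang_params_def numeral_2_eq_2\<close>)

lemma sat_foldr_Ex:
  assumes "\<forall>v. sat M v \<phi> \<longleftrightarrow> Q (v 0)" and "0 \<notin> set ns"
  shows "\<forall>v. sat M v (foldr Ex ns \<phi>) \<longleftrightarrow> Q (v 0)"
  using assms by (induction ns) auto

lemma fv_foldr_Ex: "fv (foldr Ex ns \<phi>) = fv \<phi> - set ns"
  by (induction ns) auto

lemma wf_foldr_Ex: "wf_fm L (foldr Ex ns \<phi>) \<longleftrightarrow> wf_fm L \<phi>"
  by (induction ns) auto

lemma sat_fms1: "\<phi> \<in> fms1 L A \<Longrightarrow> sat (with_params M) v \<phi> \<longleftrightarrow> sat1 M (v 0) \<phi>"
  unfolding sat1_def fms1_def by (rule sat_cong) auto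

lemma definable_over_iff_expressible:
  "definable_over L M A D \<longleftrightarrow> expressible (lang_params L A) (with_params M) (\<lambda>v. v 0 \<in> D)"
proof
  assume "definable_over L M A D"
  then obtain \<phi> where \<phi>: "\<phi> \<in> fms1 L A" and D: "D = {b. sat1 M b \<phi>}"
    unfolding definable_over_def by blast
  then show "expressible (lang_params L A) (with_params M) (\<lambda>v. v 0 \<in> D)"
    unfolding expressible_def
    by (intro exI[of _ \<phi>]) (auto simp: sat_fms1[OF \<phi>] fms1_def)
next
  assume "expressible (lang_params L A) (with_params M) (\<lambda>v. v 0 \<in> D)"
  then obtain \<phi> where \<phi>: "wf_fm (lang_params L A) \<phi>"
    and D: "\<forall>v. sat (with_params M) v \<phi> \<longleftrightarrow> v 0 \<in> D"
    unfolding expressible_def by blast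
  \<comment> \<open>The witness may have free variables other than 0. Its truth does not depend on
    them, so binding them existentially is vacuous and yields a member of
    \<open>fms1\<close>.\<close>
  obtain ns where ns: "set ns = fv \<phi> - {0}"
    using finite_list[of "fv \<phi> - {0}"] finite_fv[of \<phi>] by auto
  have "foldr Ex ns \<phi> \<in> fms1 L A"
    unfolding fms1_def using \<phi> ns by (auto simp: fv_foldr_Ex wf_foldr_Ex)
  moreover have "D = {b. sat1 M b (foldr Ex ns \<phi>)}"
    using sat_foldr_Ex[OF D, of ns] ns by (auto simp: sat1_def)
  ultimately show "definable_over L M A D"
    unfolding definable_over_def by blast
qed

lemma expressible_mem:
  assumes "definable_over L M A D"
  shows "expressible (lang_params L A) (with_params M) (\<lambda>v. v i \<in> D)"
proof (cases "i = 0")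
  case True
  then show ?thesis using assms by (simp add: definable_over_iff_expressible)
next
  case False
  \<comment> \<open>Moving \<open>D\<close> to variable \<open>i\<close> through a quantified
    variable 0 that equals it avoids substitution and its capture problems.\<close>
  have "expressible (lang_params L A) (with_params M)
      (\<lambda>v. \<exists>x. (v(0 := x)) 0 \<in> D \<and> (v(0 := x)) 0 = (v(0 := x)) i)"
    using assms
    by (intro expressible_ex[where P = "\<lambda>v. v 0 \<in> D \<and> v 0 = v i"] expressible_conj expressible_eq)
       (simp add: definable_over_iff_expressible)
  then show ?thesis using False by simp
qed

lemma fms1_mono:
  fixes L :: "('f, 'r) lang" and A B :: "'a set"
  assumes "A \<subseteq> B"
  shows "fms1 L A \<subseteq> fms1 L B"
proof -
  have tm: "wf_tm (lang_params L A) t \<Longrightarrow> wf_tm (lang_params L B) t" for t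
    using assms by (induction t) (auto simp: lang_params_def)
  have "wf_fm (lang_params L A) \<phi> \<Longrightarrow> wf_fm (lang_params L B) \<phi>" for \<phi> :: "('f + 'a, 'r) fm"
    by (induction \<phi>) (auto simp: tm, auto simp: lang_params_def)
  then show ?thesis unfolding fms1_def by blast
qed

section \<open>Exchanging parameters and variables\<close>

primrec instantiate_tm :: "(nat \<Rightarrow> 'a) \<Rightarrow> nat set \<Rightarrow> 'f tm \<Rightarrow> ('f + 'a) tm" where
  "instantiate_tm w B (Var n) = (if n \<in> B then Var n else Par (w n))"
| "instantiate_tm w B (Fun f ts) = Fun (Inl f) (map (instantiate_tm w B) ts)"

text \<open>\<open>B\<close> holds the variables that remain variables: the chosen free ones and
  those bound on the way down. The others are frozen at their values under \<open>w\<close>.\<close>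

primrec instantiate :: "(nat \<Rightarrow> 'a) \<Rightarrow> nat set \<Rightarrow> ('f, 'r) fm \<Rightarrow> ('f + 'a, 'r) fm" where
  "instantiate w B (Eq s t) = Eq (instantiate_tm w B s) (instantiate_tm w B t)"
| "instantiate w B (Rel r ts) = Rel r (map (instantiate_tm w B) ts)"
| "instantiate w B (Neg \<phi>) = Neg (instantiate w B \<phi>)"
| "instantiate w B (And \<phi> \<psi>) = And (instantiate w B \<phi>) (instantiate w B \<psi>)"
| "instantiate w B (Ex n \<phi>) = Ex n (instantiate w (insert n B) \<phi>)"

lemma eval_instantiate_tm:
  "eval_tm (with_params M) v (instantiate_tm w B t) = eval_tm M (\<lambda>n. if n \<in> B then v n else w n) t"
proof (induction t)
  case (Fun f ts)
  then have "map (eval_tm (with_params M) v \<circ> instantiate_tm w B) ts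
      = map (eval_tm M (\<lambda>n. if n \<in> B then v n else w n)) ts" by simp
  then show ?case by (simp del: map_eq_conv)
qed simp

lemma sat_instantiate:
  "sat (with_params M) v (instantiate w B \<phi>) \<longleftrightarrow> sat M (\<lambda>n. if n \<in> B then v n else w n) \<phi>"
proof (induction \<phi> arbitrary: v B)
  case (Rel r ts)
  have "map (eval_tm (with_params M) v \<circ> instantiate_tm w B) ts
      = map (eval_tm M (\<lambda>n. if n \<in> B then v n else w n)) ts" by (simp add: eval_instantiate_tm)
  then show ?case by (simp del: map_eq_conv)
next
  case (Ex n \<phi>)
  have "(\<lambda>k. if k \<in> insert n B then (v(n := x)) k else w k)
      = (\<lambda>k. if k \<in> B then v k else w k)(n := x)" for x by auto
  then show ?case by (simp only: instantiate.simps sat.simps Ex.IH)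
qed (simp_all add: eval_instantiate_tm)

lemma fv_instantiate_tm: "fv_tm (instantiate_tm w B t) \<subseteq> B"
  by (induction t) auto

lemma fv_instantiate: "fv (instantiate w B \<phi>) \<subseteq> B"
proof (induction \<phi> arbitrary: B)
  case (Ex n \<phi>)
  then show ?case using Ex.IH[of "insert n B"] by auto
qed (use fv_instantiate_tm in fastforce)+

lemma wf_instantiate_tm: "wf_tm L t \<Longrightarrow> wf_tm (lang_params L UNIV) (instantiate_tm w B t)"
  by (induction t) (auto simp: lang_params_def)

lemma wf_instantiate: "wf_fm L \<phi> \<Longrightarrow> wf_fm (lang_params L UNIV) (instantiate w B \<phi>)"
  by (induction \<phi> arbitrary: B) (auto simp: wf_instantiate_tm, auto simp: lang_params_def)

text \<open>Freezing every variable except 0 turns an \<open>L\<close>-formula with an assignment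
  into a formula with parameters, to which definable completeness applies.\<close>

lemma definable_over_UNIV_sat:
  assumes "wf_fm L \<phi>"
  shows "definable_over L M UNIV {x. sat M (w(0 := x)) \<phi>}"
proof -
  have "(\<lambda>n. if n \<in> {0} then x else w n) = w(0 := x)" for x by auto
  then have "{x. sat M (w(0 := x)) \<phi>} = {x. sat1 M x (instantiate w {0} \<phi>)}"
    by (simp only: sat1_def sat_instantiate)
  moreover have "instantiate w {0} \<phi> \<in> fms1 L UNIV"
    using wf_instantiate[OF assms] fv_instantiate[of w "{0}" \<phi>] by (auto simp: fms1_def)
  ultimately show ?thesis unfolding definable_over_def by blast
qed

text \<open>The original variables go to multiples of 3 and the parameters to indices congruent to 1,
  so that neither can clash, and the indices congruent to 2 stay fresh.\<close>

primrec abstract_tm :: "('a \<Rightarrow> nat) \<Rightarrow> ('f + 'a) tm \<Rightarrow> 'f tm" where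
  "abstract_tm g (Var n) = Var (3 * n)"
| "abstract_tm g (Fun c ts) =
    (case c of Inl f \<Rightarrow> Fun f (map (abstract_tm g) ts) | Inr a \<Rightarrow> Var (3 * g a + 1))"

primrec abstract :: "('a \<Rightarrow> nat) \<Rightarrow> ('f + 'a, 'r) fm \<Rightarrow> ('f, 'r) fm" where
  "abstract g (Eq s t) = Eq (abstract_tm g s) (abstract_tm g t)"
| "abstract g (Rel r ts) = Rel r (map (abstract_tm g) ts)"
| "abstract g (Neg \<phi>) = Neg (abstract g \<phi>)"
| "abstract g (And \<phi> \<psi>) = And (abstract g \<phi>) (abstract g \<psi>)"
| "abstract g (Ex n \<phi>) = Ex (3 * n) (abstract g \<phi>)"

lemma eval_abstract_tm:
  assumes "\<And>a. Inr a \<in> set_tm t \<Longrightarrow> w (3 * g a + 1) = a"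
  shows "eval_tm M w (abstract_tm g t) = eval_tm (with_params M) (\<lambda>n. w (3 * n)) t"
  using assms
proof (induction t)
  case (Fun c ts)
  then have "map (eval_tm M w \<circ> abstract_tm g) ts
      = map (eval_tm (with_params M) (\<lambda>n. w (3 * n))) ts" by auto
  then show ?case using Fun.prems by (cases c) (auto simp del: map_eq_conv)
qed simp

lemma sat_abstract:
  assumes "\<And>a. Inr a \<in> set1_fm \<phi> \<Longrightarrow> w (3 * g a + 1) = a"
  shows "sat M w (abstract g \<phi>) \<longleftrightarrow> sat (with_params M) (\<lambda>n. w (3 * n)) \<phi>"
  using assms
proof (induction \<phi> arbitrary: w)
  case (Eq s t)
  then show ?case by (simp add: eval_abstract_tm)
next
  case (Rel r ts)
  then have "map (eval_tm M w \<circ> abstract_tm g) ts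
      = map (eval_tm (with_params M) (\<lambda>n. w (3 * n))) ts" by (force intro: eval_abstract_tm)
  then show ?case by (simp del: map_eq_conv)
next
  case (Ex n \<phi>)
  have "sat M (w(3 * n := x)) (abstract g \<phi>)
      \<longleftrightarrow> sat (with_params M) (\<lambda>k. (w(3 * n := x)) (3 * k)) \<phi>" for x
  proof (rule Ex.IH)
    fix a assume "Inr a \<in> set1_fm \<phi>"
    \<comment> \<open>Bound variables sit at multiples of 3, so a quantifier never overwrites the
      value that stands for a parameter.\<close>
    moreover have "3 * g a + 1 \<noteq> 3 * n" by presburger
    ultimately show "(w(3 * n := x)) (3 * g a + 1) = a" using Ex.prems by simp
  qed
  moreover have "(\<lambda>k. (w(3 * n := x)) (3 * k)) = (\<lambda>k. w (3 * k))(n := x)" for x by auto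
  ultimately show ?case by simp
qed simp_all

lemma wf_abstract_tm: "wf_tm (lang_params L A) t \<Longrightarrow> wf_tm L (abstract_tm g t)"
  by (induction t) (auto simp: lang_params_def)

lemma wf_abstract: "wf_fm (lang_params L A) \<phi> \<Longrightarrow> wf_fm L (abstract g \<phi>)"
  by (induction \<phi>) (auto simp: wf_abstract_tm, auto simp: lang_params_def)

lemma fv_abstract_tm: "n \<in> fv_tm (abstract_tm g t) \<Longrightarrow> n mod 3 \<noteq> 2"
  by (induction t) (auto split: sum.splits)

lemma fv_abstract: "n \<in> fv (abstract g \<phi>) \<Longrightarrow> n mod 3 \<noteq> 2"
  by (induction \<phi>) (auto dest: fv_abstract_tm)

lemma finite_set_tm: "finite (set_tm t)"
  by (induction t) auto

lemma finite_set1_fm: "finite (set1_fm \<phi>)"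
  by (induction \<phi>) (auto simp: finite_set_tm)

lemma expands_linear_orderD:
  assumes "expands_linear_order L r M"
  shows "(r, 2) \<in> rels L" and "le r M x x"
    and "le r M x y \<Longrightarrow> le r M y z \<Longrightarrow> le r M x z"
    and "le r M x y \<Longrightarrow> le r M y x \<Longrightarrow> x = y"
    and "le r M x y \<or> le r M y x"
proof -
  have lin: "linear_order {(x, y). le r M x y}" and r: "(r, 2) \<in> rels L"
    using assms by (auto simp: expands_linear_order_def)
  note defs = linear_order_on_def partial_order_on_def preorder_on_def
  show "(r, 2) \<in> rels L" by (rule r)
  show refl: "le r M x x" for x using lin by (auto simp: defs refl_on_def)
  show "le r M x y \<Longrightarrow> le r M y z \<Longrightarrow> le r M x z"
    using lin unfolding defs trans_def by blast
  show "le r M x y \<Longrightarrow> le r M y x \<Longrightarrow> x = y"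
    using lin unfolding defs antisym_def by blast
  show "le r M x y \<or> le r M y x"
    using lin refl[of x] by (cases "x = y") (auto simp: defs total_on_def)
qed

section \<open>Transfer along the theory\<close>

text \<open>The universal closure, in a syntax whose only quantifier is \<open>Ex\<close>.
  \<open>Th\<close> contains sentences only, so the validity of an open formula has to pass from
  \<open>M\<close> to \<open>U\<close> in this form.\<close>

definition closure_fm :: "nat list \<Rightarrow> ('f, 'r) fm \<Rightarrow> ('f, 'r) fm" where
  "closure_fm ns \<phi> = foldr (\<lambda>n \<psi>. Neg (Ex n (Neg \<psi>))) ns \<phi>"

lemma wf_closure_fm: "wf_fm L (closure_fm ns \<phi>) \<longleftrightarrow> wf_fm L \<phi>"
  by (induction ns) (auto simp: closure_fm_def)

lemma fv_closure_fm: "fv (closure_fm ns \<phi>) = fv \<phi> - set ns"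
  by (induction ns) (auto simp: closure_fm_def)

lemma sat_closure_fm: "(\<forall>v. sat M v (closure_fm ns \<phi>)) \<longleftrightarrow> (\<forall>v. sat M v \<phi>)"
proof (induction ns)
  case (Cons n ns)
  have "(\<forall>v. sat M v (closure_fm (n # ns) \<phi>)) \<longleftrightarrow> (\<forall>v x. sat M (v(n := x)) (closure_fm ns \<phi>))"
    by (simp add: closure_fm_def)
  also have "\<dots> \<longleftrightarrow> (\<forall>v. sat M v (closure_fm ns \<phi>))"
    by (metis fun_upd_triv)
  finally show ?case using Cons.IH by simp
qed (simp add: closure_fm_def)

lemma sat_transfer:
  assumes "models U (Th L M)" and "wf_fm L \<phi>" and "\<And>v. sat M v \<phi>"
  shows "sat U v \<phi>"
proof -
  obtain ns where "set ns = fv \<phi>" using finite_list[OF finite_fv[of \<phi>]] by blast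
  moreover have "\<forall>v. sat M v (closure_fm ns \<phi>)"
    unfolding sat_closure_fm by (intro allI assms(3))
  ultimately have "closure_fm ns \<phi> \<in> Th L M"
    using assms(2) by (simp add: Th_def wf_closure_fm fv_closure_fm)
  then have "\<forall>v. sat U v (closure_fm ns \<phi>)"
    using assms(1) by (simp add: models_def)
  then show ?thesis unfolding sat_closure_fm by (rule spec)
qed

text \<open>Reflexivity, transitivity, antisymmetry and totality are universal statements: each is
  the validity in \<open>M\<close> of a quantifier-free formula, and so passes to
  \<open>U\<close>.\<close>

lemma expands_linear_order_transfer:
  assumes "expands_linear_order L r M" and "models U (Th L M)"
  shows "expands_linear_order L r U"
proof -
  have r: "(r, Suc (Suc 0)) \<in> rels L"
    using expands_linear_orderD(1)[OF assms(1)] by (simp add: numeral_2_eq_2)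
  note M = expands_linear_orderD(2-)[OF assms(1)]
  note transfer = sat_transfer[OF assms(2)]
  let ?v = "\<lambda>x y z n. if n = 0 then x else if n = Suc 0 then y else (z :: 'd)"
  have refl: "le r U x x" for x
  proof -
    have "sat U (?v x x x) (Rel r [Var 0, Var 0])"
      by (rule transfer) (use r M(1) in \<open>simp_all add: le_def\<close>)
    then show ?thesis by (simp add: le_def)
  qed
  have trans: "le r U x y \<Longrightarrow> le r U y z \<Longrightarrow> le r U x z" for x y z
  proof -
    have "sat U (?v x y z) (Neg (And (And (Rel r [Var 0, Var 1]) (Rel r [Var 1, Var 2]))
      (Neg (Rel r [Var 0, Var 2]))))"
      by (rule transfer, simp add: r, simp flip: le_def) (use M(2) in blast)
    then show "le r U x y \<Longrightarrow> le r U y z \<Longrightarrow> le r U x z" by (simp add: le_def)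
  qed
  have antisym: "le r U x y \<Longrightarrow> le r U y x \<Longrightarrow> x = y" for x y
  proof -
    have "sat U (?v x y y) (Neg (And (And (Rel r [Var 0, Var 1]) (Rel r [Var 1, Var 0]))
      (Neg (Eq (Var 0) (Var 1)))))"
      by (rule transfer, simp add: r, simp flip: le_def) (use M(3) in blast)
    then show "le r U x y \<Longrightarrow> le r U y x \<Longrightarrow> x = y" by (simp add: le_def)
  qed
  have total: "le r U x y \<or> le r U y x" for x y
  proof -
    have "sat U (?v x y y) (Neg (And (Neg (Rel r [Var 0, Var 1])) (Neg (Rel r [Var 1, Var 0]))))"
      by (rule transfer, simp add: r, simp flip: le_def) (use M(4) in blast)
    then show ?thesis by (auto simp: le_def)
  qed
  have "linear_order {(x, y). le r U x y}"
    unfolding linear_order_on_def partial_order_on_def preorder_on_def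
  proof (intro conjI)
    show "refl {(x, y). le r U x y}" using refl by (simp add: refl_on_def)
    show "trans {(x, y). le r U x y}" by (rule transI) (use trans in blast)
    show "antisym {(x, y). le r U x y}" by (rule antisymI) (use antisym in blast)
    show "total {(x, y). le r U x y}" using total by (simp add: total_on_def)
  qed simp
  then show ?thesis
    using r by (simp add: expands_linear_order_def numeral_2_eq_2)
qed

section \<open>Definable completeness as a first-order scheme\<close>

definition upper_bound_fm :: "'r \<Rightarrow> ('f, 'r) fm \<Rightarrow> nat \<Rightarrow> ('f, 'r) fm" where
  "upper_bound_fm r \<phi> i = Neg (Ex 0 (And \<phi> (Neg (Rel r [Var 0, Var i]))))"

text \<open>One instance of the scheme for suprema: variable 0 runs through the set, 2 through its
  bounds, and 5 holds the supremum. Both 2 and 5 are congruent to 2 modulo 3, hence not free in an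
  abstracted formula, whose remaining free variables act as parameters.\<close>

definition sup_complete_fm :: "'r \<Rightarrow> ('f, 'r) fm \<Rightarrow> ('f, 'r) fm" where
  "sup_complete_fm r \<phi> = Neg (And (And (Ex 0 \<phi>) (Ex 2 (upper_bound_fm r \<phi> 2)))
     (Neg (Ex 5 (And (upper_bound_fm r \<phi> 5)
       (Neg (Ex 2 (And (upper_bound_fm r \<phi> 2) (Neg (Rel r [Var 5, Var 2])))))))))"

lemma wf_sup_complete_fm:
  "(r, 2) \<in> rels L \<Longrightarrow> wf_fm L \<phi> \<Longrightarrow> wf_fm L (sup_complete_fm r \<phi>)"
  by (simp add: sup_complete_fm_def upper_bound_fm_def numeral_2_eq_2)

lemma sat_sup_complete_fm:
  fixes M :: "('f, 'r, 'a) struct" and \<phi> :: "('f, 'r) fm"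
  assumes "2 \<notin> fv \<phi>" and "5 \<notin> fv \<phi>"
  defines "D \<equiv> \<lambda>v. {x. sat M (v(0 := x)) \<phi>}"
  shows "sat M v (sup_complete_fm r \<phi>) \<longleftrightarrow>
    (D v \<noteq> {} \<longrightarrow> (\<exists>u. upper_bound r M (D v) u) \<longrightarrow> (\<exists>s. is_supremum r M (D v) s))"
proof -
  \<comment> \<open>Since 2 and 5 are not free in \<open>\<phi>\<close>, choosing a bound or a
    supremum does not change the set in question.\<close>
  have "sat M (w(2 := u, 0 := x)) \<phi> \<longleftrightarrow> sat M (w(0 := x)) \<phi>"
    "sat M (w(5 := u, 0 := x)) \<phi> \<longleftrightarrow> sat M (w(0 := x)) \<phi>" for w u x
    by (rule sat_cong; use assms in auto)+
  then have D: "D (w(2 := u)) = D w" "D (w(5 := u)) = D w" for w u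
    by (simp_all add: D_def)
  have ub: "sat M w (upper_bound_fm r \<phi> i) \<longleftrightarrow> upper_bound r M (D w) (w i)" if "i \<noteq> 0" for w i
    using that by (auto simp: upper_bound_fm_def upper_bound_def D_def le_def)
  have "sat M v (Ex 0 \<phi>) \<longleftrightarrow> D v \<noteq> {}" by (simp add: D_def)
  then show ?thesis
    by (simp add: sup_complete_fm_def ub D is_supremum_def le_def del: sat.simps(5))
       (auto simp: ub D le_def)
qed

text \<open>The parameters of \<open>D\<close> live in \<open>U\<close>, so \<open>M\<close> cannot
  speak of \<open>D\<close> itself. With variables in their place, the claim for all values at once
  is an \<open>L\<close>-formula valid in \<open>M\<close>. It transfers, and the variables then
  receive the original values.\<close>

lemma ex_supremum_transfer:
  assumes r: "(r, 2) \<in> rels L" and M: "definably_complete L r M" and U: "models U (Th L M)"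
    and D: "definable_over L U UNIV D" "D \<noteq> {}" "upper_bound r U D u"
  shows "\<exists>s. is_supremum r U D s"
proof -
  obtain \<phi> where \<phi>: "\<phi> \<in> fms1 L UNIV" and D_eq: "D = {b. sat1 U b \<phi>}"
    using D(1) unfolding definable_over_def by blast
  define S where "S = {a. Inr a \<in> set1_fm \<phi>}"
  have "finite S"
    unfolding S_def using finite_vimageI[OF finite_set1_fm[of \<phi>], of Inr] by (simp add: vimage_def)
  then obtain g :: "'d \<Rightarrow> nat" where g: "inj_on g S"
    using finite_imp_inj_to_nat_seg by blast
  define \<psi> where "\<psi> = abstract g \<phi>"
  have wf: "wf_fm L \<psi>"
    using \<phi> wf_abstract unfolding \<psi>_def fms1_def by blast
  have fresh: "2 \<notin> fv \<psi>" "5 \<notin> fv \<psi>"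
    unfolding \<psi>_def using fv_abstract[of 2 g \<phi>] fv_abstract[of 5 g \<phi>] by auto
  have "sat M v (sup_complete_fm r \<psi>)" for v
    unfolding sat_sup_complete_fm[OF fresh]
    using M definable_over_UNIV_sat[OF wf] unfolding definably_complete_def by blast
  then have *: "sat U v (sup_complete_fm r \<psi>)" for v
    using sat_transfer[OF U] wf_sup_complete_fm[OF r wf] by blast
  \<comment> \<open>This inverts the coding of parameters by indices: \<open>3 * g a + 1\<close>
    divided by 3 is \<open>g a\<close>, and \<open>g\<close> is injective on
    \<open>S\<close>.\<close>
  define w where "w = (\<lambda>k. inv_into S g (k div 3))"
  have w: "w (3 * g a + 1) = a" if "a \<in> S" for a
  proof -
    have "(3 * g a + 1) div 3 = g a" by presburger
    then show ?thesis using that g by (simp only: w_def inv_into_f_f)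
  qed
  have "sat U (w(0 := x)) \<psi> \<longleftrightarrow> sat1 U x \<phi>" for x
  proof -
    have "sat U (w(0 := x)) \<psi> \<longleftrightarrow> sat (with_params U) (\<lambda>n. (w(0 := x)) (3 * n)) \<phi>"
      unfolding \<psi>_def by (rule sat_abstract) (use w in \<open>simp add: S_def\<close>)
    then show ?thesis by (simp add: sat_fms1[OF \<phi>])
  qed
  then have "{x. sat U (w(0 := x)) \<psi>} = D" by (simp add: D_eq)
  then show ?thesis
    using *[of w] D(2,3) unfolding sat_sup_complete_fm[OF fresh] by auto
qed

section \<open>Types and their realisations\<close>

lemma mem_type_iff:
  assumes "p \<in> S1 L U A" and "realises U b p" and "\<phi> \<in> fms1 L A"
  shows "\<phi> \<in> p \<longleftrightarrow> sat1 U b \<phi>"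
proof
  assume "sat1 U b \<phi>"
  then have "\<not> sat1 U b (Neg \<phi>)" by (simp add: sat1_def)
  then have "Neg \<phi> \<notin> p"
    using assms(2) unfolding realises_def by blast
  then show "\<phi> \<in> p" using assms(1,3) unfolding S1_def by blast
next
  assume "\<phi> \<in> p"
  then show "sat1 U b \<phi>" using assms(2) unfolding realises_def by blast
qed

text \<open>A complete type decides every formula over \<open>A\<close>. This passes information
  from one realisation to all others.\<close>

lemma realisations_definable:
  assumes "p \<in> S1 L U A" and "realises U b p" and "realises U c p"
    and "definable_over L U A D"
  shows "b \<in> D \<longleftrightarrow> c \<in> D"
proof -
  obtain \<phi> where "\<phi> \<in> fms1 L A" "D = {b. sat1 U b \<phi>}"
    using assms(4) unfolding definable_over_def by blast
  then show ?thesis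
    using mem_type_iff[OF assms(1,2), of \<phi>] mem_type_iff[OF assms(1,3), of \<phi>] by simp
qed

lemma type_of_element: "{\<phi> \<in> fms1 L A. sat1 U b \<phi>} \<in> S1 L U A"
proof -
  let ?p = "{\<phi> \<in> fms1 L A. sat1 U b \<phi>}"
  have "realises U b F" if "F \<subseteq> ?p" for F
    using that by (auto simp: realises_def)
  moreover have "\<phi> \<in> ?p \<or> Neg \<phi> \<in> ?p" if "\<phi> \<in> fms1 L A" for \<phi>
    using that by (simp add: sat1_def fms1_def)
  ultimately show ?thesis unfolding S1_def by blast
qed

text \<open>A finite subset of the union of a chain lies in one of its members, so Zorn's lemma
  gives a maximal finitely satisfiable extension. Maximality forces completeness.\<close>

lemma extend_to_type:
  assumes "\<Sigma> \<subseteq> fms1 L A" and "\<And>F. F \<subseteq> \<Sigma> \<Longrightarrow> finite F \<Longrightarrow> \<exists>b. realises U b F"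
  shows "\<exists>p \<in> S1 L U A. \<Sigma> \<subseteq> p"
proof -
  define fsat where "fsat p \<longleftrightarrow> (\<forall>F. F \<subseteq> p \<and> finite F \<longrightarrow> (\<exists>b. realises U b F))" for p
  define \<P> where "\<P> = {p. \<Sigma> \<subseteq> p \<and> p \<subseteq> fms1 L A \<and> fsat p}"
  have "\<Sigma> \<in> \<P>" using assms unfolding \<P>_def fsat_def by blast
  moreover have "\<Union>\<C> \<in> \<P>" if C: "\<C> \<noteq> {}" "subset.chain \<P> \<C>" for \<C>
  proof -
    have "fsat (\<Union>\<C>)"
      unfolding fsat_def
    proof (intro allI impI)
      fix F assume F: "F \<subseteq> \<Union>\<C> \<and> finite F"
      then obtain p where "p \<in> \<C>" "F \<subseteq> p"
        using finite_subset_Union_chain[of F \<C> \<P>] C by blast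
      then show "\<exists>b. realises U b F"
        using F C(2) unfolding subset.chain_def \<P>_def fsat_def by blast
    qed
    then show ?thesis
      using C unfolding subset.chain_def \<P>_def by blast
  qed
  ultimately obtain p where p: "p \<in> \<P>" and max: "\<And>q. q \<in> \<P> \<Longrightarrow> p \<subseteq> q \<Longrightarrow> q = p"
    using subset_Zorn_nonempty[of \<P>] by blast
  \<comment> \<open>If \<open>\<phi>\<close> is left out, \<open>insert \<phi> p\<close> fails on
    some finite set. Dropping \<open>\<phi>\<close> from that set leaves a finite part of
    \<open>p\<close> that excludes \<open>\<phi>\<close>.\<close>
  have bad: "\<exists>F. F \<subseteq> p \<and> finite F \<and> (\<forall>b. realises U b F \<longrightarrow> \<not> sat1 U b \<phi>)"
    if "\<phi> \<in> fms1 L A" "\<phi> \<notin> p" for \<phi>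
  proof -
    have "insert \<phi> p \<notin> \<P>" using max[of "insert \<phi> p"] that by blast
    then have "\<not> fsat (insert \<phi> p)" using p that(1) unfolding \<P>_def by blast
    then obtain F where F: "F \<subseteq> insert \<phi> p" "finite F" "\<not> (\<exists>b. realises U b F)"
      unfolding fsat_def by blast
    have "\<not> sat1 U b \<phi>" if "realises U b (F - {\<phi>})" for b
      using F(3) that unfolding realises_def by blast
    moreover have "F - {\<phi>} \<subseteq> p" "finite (F - {\<phi>})" using F(1,2) by auto
    ultimately show ?thesis by blast
  qed
  have "\<phi> \<in> p \<or> Neg \<phi> \<in> p" if \<phi>: "\<phi> \<in> fms1 L A" for \<phi>
  proof (rule ccontr)
    assume "\<not> ?thesis"
    moreover have "Neg \<phi> \<in> fms1 L A" using \<phi> by (simp add: fms1_def)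
    ultimately obtain F G where FG: "F \<subseteq> p" "finite F" "G \<subseteq> p" "finite G"
      "\<forall>b. realises U b F \<longrightarrow> \<not> sat1 U b \<phi>" "\<forall>b. realises U b G \<longrightarrow> \<not> sat1 U b (Neg \<phi>)"
      using bad[of \<phi>] bad[of "Neg \<phi>"] \<phi> by blast
    \<comment> \<open>A common realisation of \<open>F\<close> and \<open>G\<close> would satisfy
      neither \<open>\<phi>\<close> nor its negation.\<close>
    have "fsat p" using p by (simp add: \<P>_def)
    moreover have "F \<union> G \<subseteq> p \<and> finite (F \<union> G)" using FG(1-4) by simp
    ultimately obtain b where b: "realises U b (F \<union> G)"
      unfolding fsat_def by blast
    then have "realises U b F" "realises U b G" by (simp_all add: realises_def)
    then have "\<not> sat1 U b \<phi>" "\<not> sat1 U b (Neg \<phi>)" using FG(5,6) by simp_all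
    then show False by (simp add: sat1_def)
  qed
  then have "p \<in> S1 L U A" using p unfolding S1_def \<P>_def fsat_def by blast
  then show ?thesis using p unfolding \<P>_def by blast
qed

section \<open>Smallness, sets definable over \<open>A\<close>, and cuts read off
  realisations\<close>

lemma definable_over_realises:
  assumes "finite F" and "F \<subseteq> fms1 L A"
  shows "definable_over L U A {b. realises U b F}"
  using assms
proof induction
  case empty
  have "expressible (lang_params L A) (with_params U) (\<lambda>v. v 0 = v 0)"
    by (rule expressible_eq)
  then show ?case by (simp add: definable_over_iff_expressible realises_def)
next
  case (insert \<phi> F)
  have "definable_over L U A {b. sat1 U b \<phi>}"
    using insert.prems unfolding definable_over_def by blast
  then have "expressible (lang_params L A) (with_params U) (\<lambda>v. v 0 \<in> {b. sat1 U b \<phi>} \<and> v 0 \<in> {b. realises U b F})"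
    using insert by (intro expressible_conj) (auto simp: definable_over_iff_expressible)
  then show ?case by (simp add: definable_over_iff_expressible realises_def)
qed

text \<open>The formulas \<open>Eq (Var n) (Var n)\<close> are infinitely many, so
  \<open>\<kappa>\<close> is infinite, and one further element cannot lift a smaller cardinal to
  it.\<close>

lemma small_insert:
  assumes "monster_model \<kappa> L T U" and "small \<kappa> A"
  shows "small \<kappa> (insert b A)"
proof -
  have \<kappa>: "Card_order \<kappa>" "|{\<phi>. wf_fm L \<phi>}| <o \<kappa>"
    using assms(1) by (auto simp: monster_model_def)
  have "infinite (range (\<lambda>n. Eq (Var n) (Var n) :: ('b, 'c) fm))"
    by (auto dest!: finite_imageD simp: inj_on_def)
  moreover have "range (\<lambda>n. Eq (Var n) (Var n)) \<subseteq> {\<phi>. wf_fm L \<phi>}" by auto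
  ultimately have "infinite {\<phi>. wf_fm L \<phi>}" using finite_subset by blast
  moreover have "|{\<phi>. wf_fm L \<phi>}| \<le>o |Field \<kappa>|"
    using \<kappa> by (meson card_of_Field_ordIso ordIso_symmetric ordLess_imp_ordLeq ordLeq_ordIso_trans)
  ultimately have inf: "infinite (Field \<kappa>)" using card_of_ordLeq_infinite by blast
  have "|{b}| <o \<kappa>"
    by (rule finite_ordLess_infinite)
       (use inf card_order_on_well_order_on[OF \<kappa>(1)] in \<open>simp_all add: card_of_well_order_on Field_card_of\<close>)
  then have "|{b} \<union> A| <o \<kappa>"
    using assms(2) unfolding small_def by (rule card_of_Un_ordLess_infinite_Field[OF inf \<kappa>(1)])
  then show ?thesis by (simp add: small_def)
qed

text \<open>An element of \<open>dcl L U A\<close> need not be a constant of the language over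
  \<open>A\<close>; it is quantified away by means of the formula defining its singleton.\<close>

lemma dcl_le_definable:
  assumes "(r, 2) \<in> rels L" and "a \<in> dcl L U A"
  shows "definable_over L U A {b. le r U a b}" and "definable_over L U A {b. le r U b a}"
proof -
  note le = expressible_le[OF assms(1), of A U]
  have a: "definable_over L U A {a}" using assms(2) by (simp add: dcl_def)
  show "definable_over L U A {b. le r U a b}"
    using expressible_ex[OF expressible_conj[OF expressible_mem[OF a, of 1] le[of 1 0]], of 1]
    by (simp add: definable_over_iff_expressible)
  show "definable_over L U A {b. le r U b a}"
    using expressible_ex[OF expressible_conj[OF expressible_mem[OF a, of 1] le[of 0 1]], of 1]
    by (simp add: definable_over_iff_expressible)
qed

text \<open>Each \<open>a\<close> in \<open>dcl\<close> bounds two rays definable over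
  \<open>A\<close>, and a ray with one realisation of \<open>p\<close> contains them all. Entailment
  can thus be tested at \<open>b\<close> alone.\<close>

lemma cut_of_realisation:
  assumes "(r, 2) \<in> rels L" and "p \<in> S1 L U A" and "realises U b p"
  shows "cut_of L r U A p = ({a \<in> dcl L U A. le r U a b}, {a \<in> dcl L U A. le r U b a})"
proof -
  have "sat1 U c (Rel r [Par a, Var 0]) \<longleftrightarrow> le r U a c"
    "sat1 U c (Rel r [Var 0, Par a]) \<longleftrightarrow> le r U c a" for a c
    by (simp_all add: sat1_def le_def)
  moreover have "le r U a b \<longleftrightarrow> le r U a c" "le r U b a \<longleftrightarrow> le r U c a"
    if "a \<in> dcl L U A" "realises U c p" for a c
    using realisations_definable[OF assms(2,3) that(2) dcl_le_definable(1)[OF assms(1) that(1)]]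
      realisations_definable[OF assms(2,3) that(2) dcl_le_definable(2)[OF assms(1) that(1)]]
    by simp_all
  ultimately have "entails U p (Rel r [Par a, Var 0]) \<longleftrightarrow> le r U a b"
    "entails U p (Rel r [Var 0, Par a]) \<longleftrightarrow> le r U b a" if "a \<in> dcl L U A" for a
    using assms(3) that unfolding entails_def by blast+
  then show ?thesis unfolding cut_of_def by (simp cong: conj_cong)
qed

text \<open>Being the supremum of \<open>D\<close> is a first-order condition over \<open>A\<close>,
  and antisymmetry leaves only one element that meets it.\<close>

lemma supremum_in_dcl:
  assumes lin: "expands_linear_order L r U" and D: "definable_over L U A D"
    and s: "is_supremum r U D s"
  shows "s \<in> dcl L U A"
proof -
  let ?ex = "expressible (lang_params L A) (with_params U)"
  note le = expressible_le[of r L A U]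
  have r: "(r, 2) \<in> rels L" and asym: "\<And>x y. le r U x y \<Longrightarrow> le r U y x \<Longrightarrow> x = y"
    using expands_linear_orderD[OF lin] by blast+
  \<comment> \<open>The quantified variable \<open>Suc i\<close> is chosen to differ from
    \<open>i\<close>.\<close>
  have ub: "?ex (\<lambda>v. upper_bound r U D (v i))" for i
    using expressible_not[OF expressible_ex[OF expressible_conj[OF
          expressible_mem[OF D, of "Suc i"] expressible_not[OF le[OF r, of "Suc i" i]]], of "Suc i"]]
    by (simp add: upper_bound_def Ball_def)
  have "?ex (\<lambda>v. \<forall>u. upper_bound r U D u \<longrightarrow> le r U (v 0) u)"
    using expressible_not[OF expressible_ex[OF expressible_conj[OF
          ub[of 1] expressible_not[OF le[OF r, of 0 1]]], of 1]]
    by simp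
  then have "?ex (\<lambda>v. is_supremum r U D (v 0))"
    unfolding is_supremum_def by (rule expressible_conj[OF ub])
  moreover have "is_supremum r U D t \<longleftrightarrow> t = s" for t
    using s asym unfolding is_supremum_def by blast
  ultimately show ?thesis by (simp add: dcl_def definable_over_iff_expressible)
qed

section \<open>Comparing types and cuts\<close>

text \<open>The assumption \<open>sup\<close> is definable completeness of \<open>U\<close> for
  suprema. It enters once the gap between the realisations of \<open>q\<close> and those of
  \<open>p\<close> is captured by a set definable over \<open>A\<close>.\<close>

lemma separating_element:
  assumes lin: "expands_linear_order L r U"
    and sup: "\<forall>D u. definable_over L U UNIV D \<longrightarrow> D \<noteq> {} \<longrightarrow> upper_bound r U D u
      \<longrightarrow> (\<exists>s. is_supremum r U D s)"
    and monster: "monster_model \<kappa> L T U" and small: "small \<kappa> A"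
    and p: "p \<in> S1 L U A" and q: "q \<in> S1 L U A" and npq: "\<not> lessapprox r U p q"
  obtains s where "s \<in> dcl L U A"
    and "\<And>\<alpha>. realises U \<alpha> p \<Longrightarrow> le r U s \<alpha>" and "\<And>\<beta>. realises U \<beta> q \<Longrightarrow> le r U \<beta> s"
proof -
  have real: "\<exists>b. realises U b t" if "small \<kappa> B" "t \<in> S1 L U B" for t B
    using monster that unfolding monster_model_def saturated_def by blast
  have r: "(r, 2) \<in> rels L" and total: "\<And>x y. le r U x y \<or> le r U y x"
    using expands_linear_orderD[OF lin] by blast+
  obtain \<alpha> \<beta> where \<alpha>: "realises U \<alpha> p" and \<beta>: "realises U \<beta> q"
    using real small p q by meson
  have pA: "p \<subseteq> fms1 L A" using p by (simp add: S1_def)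
  define \<chi> :: "('a + 'c, 'b) fm" where "\<chi> = Rel r [Var 0, Par \<beta>]"
  have \<chi>: "sat1 U b \<chi> \<longleftrightarrow> le r U b \<beta>" for b
    by (simp add: \<chi>_def sat1_def le_def)
  \<comment> \<open>Otherwise \<open>p\<close> together with \<open>x \<le> \<beta>\<close> is
    finitely satisfiable, and saturation over \<open>insert \<beta> A\<close> gives a realisation of
    \<open>p\<close> at most \<open>\<beta>\<close>, against \<open>npq\<close>.\<close>
  have "\<exists>F. F \<subseteq> p \<and> finite F \<and> (\<forall>b. realises U b F \<longrightarrow> \<not> le r U b \<beta>)"
  proof (rule ccontr)
    assume no: "\<not> ?thesis"
    have "insert \<chi> p \<subseteq> fms1 L (insert \<beta> A)"
    proof -
      have "\<chi> \<in> fms1 L (insert \<beta> A)"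
        using r by (simp add: fms1_def \<chi>_def lang_params_def numeral_2_eq_2)
      then show ?thesis
        using pA fms1_mono[of A "insert \<beta> A" L] by blast
    qed
    moreover have "\<exists>b. realises U b F" if "F \<subseteq> insert \<chi> p" "finite F" for F
    proof -
      have "F - {\<chi>} \<subseteq> p" "finite (F - {\<chi>})" using that by auto
      then obtain b where "realises U b (F - {\<chi>})" "le r U b \<beta>" using no by blast
      then have "realises U b F" using \<chi> by (auto simp: realises_def)
      then show ?thesis by blast
    qed
    ultimately obtain t where "t \<in> S1 L U (insert \<beta> A)" "insert \<chi> p \<subseteq> t"
      using extend_to_type by meson
    then obtain b where "realises U b (insert \<chi> p)"
      using real[OF small_insert[OF monster small]] by (meson realises_def subsetD)
    then have "realises U b p" "le r U b \<beta>" using \<chi> by (auto simp: realises_def)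
    then show False using npq \<beta> by (auto simp: lessapprox_def)
  qed
  then obtain F where F: "F \<subseteq> p" "finite F" and below: "\<And>b. realises U b F \<Longrightarrow> \<not> le r U b \<beta>"
    by blast
  define P where "P = {b. realises U b F}"
  have P: "definable_over L U A P"
    unfolding P_def using definable_over_realises F pA by blast
  \<comment> \<open>By totality these are the strict lower bounds of \<open>P\<close>. Passing
    through \<open>P\<close> keeps the parameters in \<open>A\<close>, although
    \<open>\<beta>\<close> was used to find \<open>F\<close>.\<close>
  define D where "D = {y. \<not> (\<exists>x. x \<in> P \<and> le r U x y)}"
  have D: "definable_over L U A D"
    using expressible_not[OF expressible_ex[OF expressible_conj[OF
          expressible_mem[OF P, of 1] expressible_le[OF r, of A U 1 0]], of 1]]
    by (simp add: definable_over_iff_expressible D_def)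
  have "\<beta> \<in> D" using below by (auto simp: D_def P_def)
  have ub: "upper_bound r U D a" if "realises U a p" for a
  proof -
    have "a \<in> P" using that F(1) by (auto simp: P_def realises_def)
    then show ?thesis using total by (auto simp: upper_bound_def D_def)
  qed
  have "definable_over L U UNIV D"
    using D fms1_mono[of A UNIV L] unfolding definable_over_def by blast
  then obtain s where s: "is_supremum r U D s"
    using sup ub[OF \<alpha>] \<open>\<beta> \<in> D\<close> by blast
  show thesis
  proof
    show "s \<in> dcl L U A" by (rule supremum_in_dcl[OF lin D s])
    show "le r U s a" if "realises U a p" for a
      using s ub[OF that] by (simp add: is_supremum_def)
    \<comment> \<open>\<open>D\<close> is definable over \<open>A\<close> and contains one
      realisation of \<open>q\<close>, hence all of them.\<close>
    show "le r U b s" if "realises U b q" for b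
      using realisations_definable[OF q \<beta> that D] \<open>\<beta> \<in> D\<close> s
      by (auto simp: is_supremum_def upper_bound_def)
  qed
qed

lemma lessapprox_iff_cut_le:
  assumes lin: "expands_linear_order L r U"
    and sup: "\<forall>D u. definable_over L U UNIV D \<longrightarrow> D \<noteq> {} \<longrightarrow> upper_bound r U D u
      \<longrightarrow> (\<exists>s. is_supremum r U D s)"
    and monster: "monster_model \<kappa> L T U" and small: "small \<kappa> A"
    and p: "p \<in> S1 L U A" and q: "q \<in> S1 L U A"
  shows "lessapprox r U p q \<longleftrightarrow> fst (cut_of L r U A p) \<subseteq> fst (cut_of L r U A q)
    \<and> snd (cut_of L r U A q) \<subseteq> snd (cut_of L r U A p)"
proof -
  have r: "(r, 2) \<in> rels L" and refl: "\<And>x. le r U x x"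
    and trans: "\<And>x y z. le r U x y \<Longrightarrow> le r U y z \<Longrightarrow> le r U x z"
    using expands_linear_orderD[OF lin] by blast+
  note cut = cut_of_realisation[OF r]
  show ?thesis
  proof
    assume "lessapprox r U p q"
    then obtain \<alpha> \<beta> where *: "realises U \<alpha> p" "realises U \<beta> q" "le r U \<alpha> \<beta>"
      by (auto simp: lessapprox_def)
    show "fst (cut_of L r U A p) \<subseteq> fst (cut_of L r U A q)
      \<and> snd (cut_of L r U A q) \<subseteq> snd (cut_of L r U A p)"
      unfolding cut[OF p *(1)] cut[OF q *(2)] using trans *(3) by auto
  next
    assume cuts: "fst (cut_of L r U A p) \<subseteq> fst (cut_of L r U A q)
      \<and> snd (cut_of L r U A q) \<subseteq> snd (cut_of L r U A p)"
    show "lessapprox r U p q"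
    proof (rule ccontr)
      assume npq: "\<not> lessapprox r U p q"
      obtain s where s: "s \<in> dcl L U A"
        "\<And>\<alpha>. realises U \<alpha> p \<Longrightarrow> le r U s \<alpha>" "\<And>\<beta>. realises U \<beta> q \<Longrightarrow> le r U \<beta> s"
        using separating_element[OF lin sup monster small p q npq] by blast
      obtain \<alpha> \<beta> where *: "realises U \<alpha> p" "realises U \<beta> q"
        using monster small p q unfolding monster_model_def saturated_def by meson
      \<comment> \<open>\<open>s\<close> lies in the left part of the cut of \<open>p\<close> and in
        the right part of the cut of \<open>q\<close>. The inclusion of left parts gives
        \<open>s \<le> \<beta>\<close>, that of right parts \<open>\<alpha> \<le> s\<close>.\<close>
      have "le r U \<alpha> s" "le r U s \<beta>"
        using cuts s * unfolding cut[OF p *(1)] cut[OF q *(2)] by auto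
      then have "le r U \<alpha> \<beta>" by (rule trans)
      then show False using npq * by (auto simp: lessapprox_def)
    qed
  qed
qed

section \<open>The order of cuts and its transport to the quotient\<close>

lemma CC_eq_range:
  assumes "expands_linear_order L r U"
  shows "CC L r U A = range (\<lambda>b. ({a \<in> dcl L U A. le r U a b}, {a \<in> dcl L U A. le r U b a}))"
proof -
  note trans = expands_linear_orderD(3)[OF assms] and total = expands_linear_orderD(5)[OF assms]
  \<comment> \<open>The pair of any element satisfies the first two conditions in \<open>CC\<close>,
    by totality and transitivity, so only being realised restricts a pair.\<close>
  have "{a \<in> dcl L U A. le r U a b} \<union> {a \<in> dcl L U A. le r U b a} = dcl L U A" for b
    using total by blast
  moreover have "le r U x y" if "x \<in> {a \<in> dcl L U A. le r U a b}" "y \<in> {a \<in> dcl L U A. le r U b a}"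
    for b x y
    using trans that by blast
  ultimately show ?thesis unfolding CC_def realises_cut_def image_def by blast
qed

text \<open>The order on classes is obtained from the order on cuts in this way, which spares a
  direct proof of its transitivity and totality through realisations.\<close>

lemma linear_order_on_pullback:
  assumes "linear_order_on Y S" and "inj_on h X" and "h ` X \<subseteq> Y"
  shows "linear_order_on X {(x, x'). x \<in> X \<and> x' \<in> X \<and> (h x, h x') \<in> S}"
proof -
  have S: "\<And>y. y \<in> Y \<Longrightarrow> (y, y) \<in> S" "trans S" "antisym S" "total_on Y S"
    using assms(1)
    by (simp_all add: linear_order_on_def partial_order_on_def preorder_on_def refl_on_def)
  let ?R = "{(x, x'). x \<in> X \<and> x' \<in> X \<and> (h x, h x') \<in> S}"
  have hY: "h x \<in> Y" if "x \<in> X" for x using assms(3) that by blast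
  show ?thesis
    unfolding linear_order_on_def partial_order_on_def preorder_on_def
  proof (intro conjI)
    show "refl_on X ?R" using S(1) hY by (simp add: refl_on_def)
    show "trans ?R" by (rule transI) (use S(2) in \<open>auto elim: transE\<close>)
    show "antisym ?R"
      by (rule antisymI) (use S(3) assms(2) in \<open>auto dest: antisymD inj_onD\<close>)
    show "total_on X ?R"
    proof (rule total_onI)
      fix x y assume xy: "x \<in> X" "y \<in> X" "x \<noteq> y"
      then have "h x \<noteq> h y" using assms(2) by (simp add: inj_on_eq_iff)
      then have "(h x, h y) \<in> S \<or> (h y, h x) \<in> S"
        using S(4) hY xy unfolding total_on_def by blast
      then show "(x, y) \<in> ?R \<or> (y, x) \<in> ?R" using xy by simp
    qed
    show "?R \<subseteq> X \<times> X" by blast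
  qed
qed

theorem theorem3p9:
  fixes L :: "('f, 'r) lang" and r :: 'r
    and M :: "('f, 'r, 'm) struct" and U :: "('f, 'r, 'a) struct"
    and \<kappa> :: "'k rel" and A :: "'a set"
  assumes "expands_linear_order L r M"
    and "definably_complete L r M"
    and "monster_model \<kappa> L (Th L M) U"
    and "small \<kappa> A"
  shows "equiv (S1 L U A) (approx L r U A)
    \<and> cut_of L r U A ` S1 L U A \<subseteq> CC L r U A
    \<and> cut_of L r U A respects approx L r U A
    \<and> (\<forall>p \<in> S1 L U A. class_cut L r U A (approx L r U A `` {p}) = cut_of L r U A p)
    \<and> linear_order_iso (S1_quot L r U A) (S1_quot_order L r U A)
        (CC L r U A) (CC_order L r U A) (class_cut L r U A)"
proof -
  let ?S = "S1 L U A" and ?E = "approx L r U A" and ?cut = "cut_of L r U A"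
  let ?C = "CC L r U A" and ?h = "class_cut L r U A"
  have U: "models U (Th L M)" using assms(3) by (simp add: monster_model_def)
  have lin: "expands_linear_order L r U"
    by (rule expands_linear_order_transfer[OF assms(1) U])
  have r: "(r, 2) \<in> rels L"
    and trans: "\<And>x y z. le r U x y \<Longrightarrow> le r U y z \<Longrightarrow> le r U x z"
    and total: "\<And>x y. le r U x y \<or> le r U y x"
    using expands_linear_orderD[OF lin] by blast+
  have le_iff: "lessapprox r U p q \<longleftrightarrow> fst (?cut p) \<subseteq> fst (?cut q) \<and> snd (?cut q) \<subseteq> snd (?cut p)"
    if "p \<in> ?S" "q \<in> ?S" for p q
  proof (rule lessapprox_iff_cut_le[OF lin _ assms(3,4) that])
    show "\<forall>D u. definable_over L U UNIV D \<longrightarrow> D \<noteq> {} \<longrightarrow> upper_bound r U D u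
      \<longrightarrow> (\<exists>s. is_supremum r U D s)"
      using ex_supremum_transfer[OF r assms(2) U] by blast
  qed
  \<comment> \<open>\<open>approx\<close> is the kernel of the cut map on \<open>S1\<close>; that it
    is an equivalence and that the cut is constant on classes follow at once.\<close>
  have E_iff: "(p, q) \<in> ?E \<longleftrightarrow> p \<in> ?S \<and> q \<in> ?S \<and> ?cut p = ?cut q" for p q
    using le_iff by (auto simp: approx_def prod_eq_iff)
  have equiv: "equiv ?S ?E"
    by (rule equivI) (auto simp: E_iff refl_on_def sym_def trans_def)
  have cut_range: "?cut p \<in> ?C" if p: "p \<in> ?S" for p
  proof -
    obtain b where b: "realises U b p"
      using p assms(3,4) unfolding monster_model_def saturated_def by blast
    show ?thesis
      unfolding cut_of_realisation[OF r p b] CC_eq_range[OF lin] by (rule rangeI)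
  qed
  have C_realised: "\<exists>b. c = ({a \<in> dcl L U A. le r U a b}, {a \<in> dcl L U A. le r U b a})"
    if "c \<in> ?C" for c
    using that unfolding CC_eq_range[OF lin] by (rule rangeE) (rule exI)
  \<comment> \<open>A consistent cut comes with an element \<open>b\<close> realising it, and the
    complete type of \<open>b\<close> over \<open>A\<close> is a preimage.\<close>
  have cut_surj: "\<exists>p \<in> ?S. ?cut p = c" if c: "c \<in> ?C" for c
  proof -
    obtain b where b: "c = ({a \<in> dcl L U A. le r U a b}, {a \<in> dcl L U A. le r U b a})"
      using C_realised[OF c] by blast
    have "realises U b {\<phi> \<in> fms1 L A. sat1 U b \<phi>}" by (simp add: realises_def)
    from cut_of_realisation[OF r type_of_element this] show ?thesis
      unfolding b by (rule bexI[OF _ type_of_element])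
  qed
  have h: "?h (?E `` {p}) = ?cut p" if "p \<in> ?S" for p
  proof -
    \<comment> \<open>The image of a class is a singleton, which gives \<open>the_elem\<close> its
      intended value.\<close>
    have "?cut ` (?E `` {p}) = {?cut p}" using that by (auto simp: E_iff)
    then show ?thesis by (simp add: class_cut_def)
  qed
  have Q: "S1_quot L r U A = (\<lambda>p. ?E `` {p}) ` ?S"
    by (auto simp: S1_quot_def quotient_def)
  have CC_order_iff: "(c, d) \<in> CC_order L r U A \<longleftrightarrow>
      c \<in> ?C \<and> d \<in> ?C \<and> fst c \<subseteq> fst d \<and> snd d \<subseteq> snd c" for c d
    by (cases c; cases d) (simp add: CC_order_def)
  have order_iff: "(X, Y) \<in> S1_quot_order L r U A \<longleftrightarrow> (?h X, ?h Y) \<in> CC_order L r U A"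
    if XY: "X \<in> S1_quot L r U A" "Y \<in> S1_quot L r U A" for X Y
  proof -
    obtain p q where p: "p \<in> ?S" "X = ?E `` {p}" and q: "q \<in> ?S" "Y = ?E `` {q}"
      using XY Q by auto
    have "(X, Y) \<in> S1_quot_order L r U A \<longleftrightarrow> (\<exists>p' \<in> X. \<exists>q' \<in> Y. lessapprox r U p' q')"
      using XY by (simp add: S1_quot_order_def)
    \<comment> \<open>A change of representatives preserves both cuts, and by \<open>le_iff\<close>
      only the cuts matter.\<close>
    also have "\<dots> \<longleftrightarrow> lessapprox r U p q"
    proof
      assume "\<exists>p' \<in> X. \<exists>q' \<in> Y. lessapprox r U p' q'"
      then obtain p' q' where *: "(p, p') \<in> ?E" "(q, q') \<in> ?E" "lessapprox r U p' q'"
        unfolding p(2) q(2) by blast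
      then show "lessapprox r U p q" using le_iff by (simp add: E_iff)
    next
      assume "lessapprox r U p q"
      moreover have "p \<in> X" "q \<in> Y" using p q by (simp_all add: E_iff)
      ultimately show "\<exists>p' \<in> X. \<exists>q' \<in> Y. lessapprox r U p' q'" by blast
    qed
    finally show ?thesis
      using p q h cut_range le_iff by (simp add: CC_order_iff)
  qed
  have inj: "inj_on ?h (S1_quot L r U A)"
  proof (rule inj_onI)
    fix X Y assume XY: "X \<in> S1_quot L r U A" "Y \<in> S1_quot L r U A" and eq: "?h X = ?h Y"
    then obtain p q where p: "p \<in> ?S" "X = ?E `` {p}" and q: "q \<in> ?S" "Y = ?E `` {q}"
      using Q by auto
    then have "(p, q) \<in> ?E" using eq h by (simp add: E_iff)
    then show "X = Y" using equiv_class_eq[OF equiv] p q by simp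
  qed
  have image: "?h ` S1_quot L r U A = ?C"
  proof -
    have "?h ` S1_quot L r U A = ?cut ` ?S"
      unfolding Q image_image by (rule image_cong[OF refl h])
    also have "\<dots> = ?C"
      using cut_range cut_surj by blast
    finally show ?thesis .
  qed
  \<comment> \<open>Inclusion of pairs is not total in general; here totality comes from comparing
    the realising elements \<open>b\<close> and \<open>b'\<close>.\<close>
  have C_total: "(c, d) \<in> CC_order L r U A \<or> (d, c) \<in> CC_order L r U A"
    if c: "c \<in> ?C" and d: "d \<in> ?C" for c d
  proof -
    obtain b b' where *: "c = ({a \<in> dcl L U A. le r U a b}, {a \<in> dcl L U A. le r U b a})"
      "d = ({a \<in> dcl L U A. le r U a b'}, {a \<in> dcl L U A. le r U b' a})"
      using C_realised[OF c] C_realised[OF d] by blast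
    have cuts: "{a \<in> dcl L U A. le r U a x} \<subseteq> {a \<in> dcl L U A. le r U a y}
        \<and> {a \<in> dcl L U A. le r U y a} \<subseteq> {a \<in> dcl L U A. le r U x a}"
      if "le r U x y" for x y
      using trans that by blast
    have "fst c \<subseteq> fst d \<and> snd d \<subseteq> snd c \<or> fst d \<subseteq> fst c \<and> snd c \<subseteq> snd d"
      unfolding * fst_conv snd_conv using total[of b b'] by (rule disj_forward) (erule cuts)+
    then show ?thesis using c d by (auto simp: CC_order_iff)
  qed
  have C_lin: "linear_order_on ?C (CC_order L r U A)"
    unfolding linear_order_on_def partial_order_on_def preorder_on_def
  proof (intro conjI)
    show "refl_on ?C (CC_order L r U A)" by (simp add: refl_on_def CC_order_iff)
    show "trans (CC_order L r U A)" by (rule transI) (auto simp: CC_order_iff)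
    show "antisym (CC_order L r U A)" by (rule antisymI) (auto simp: CC_order_iff prod_eq_iff)
    show "total_on ?C (CC_order L r U A)" using C_total by (simp add: total_on_def)
    show "CC_order L r U A \<subseteq> ?C \<times> ?C" by (auto simp: CC_order_iff)
  qed
  have "S1_quot_order L r U A = {(X, Y). X \<in> S1_quot L r U A \<and> Y \<in> S1_quot L r U A
      \<and> (?h X, ?h Y) \<in> CC_order L r U A}"
  proof -
    have "S1_quot_order L r U A \<subseteq> S1_quot L r U A \<times> S1_quot L r U A"
      unfolding S1_quot_order_def by blast
    then show ?thesis using order_iff by blast
  qed
  then have Q_lin: "linear_order_on (S1_quot L r U A) (S1_quot_order L r U A)"
    using linear_order_on_pullback[OF C_lin inj] image by simp
  have iso: "linear_order_iso (S1_quot L r U A) (S1_quot_order L r U A) ?C (CC_order L r U A) ?h"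
    unfolding linear_order_iso_def bij_betw_def
    using Q_lin C_lin inj image order_iff by blast
  have "?cut respects ?E" by (rule congruentI) (simp add: E_iff)
  moreover have "?cut ` ?S \<subseteq> ?C" using cut_range by blast
  moreover have "\<forall>p \<in> ?S. ?h (?E `` {p}) = ?cut p" using h by blast
  ultimately show ?thesis using equiv iso by blast
qed

end
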